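(* For all integers $d \ge m \ge 1$ where $d$ is a multiple of $m$, there exists a graph $G$ and a partition $\mathcal{P}$ of $V(G)$ such that $G$ has maximum degree $d$, local degree $m$ and multiplicity $m$ (with respect to $\mathcal{P}$), $|V_i| \ge d + 2m - \left\lceil \frac{2m^2 + m}{d + m}\right\rceil$ for every $V_i \in \mathcal{P}$, and $G$ has no independent transversal with respect to $\mathcal{P}$.
   Context: Graphs are finite and simple. Let $G$ be a graph and $\mathcal{P} = \{V_1, \ldots, V_r\}$ a partition of $V(G)$ into blocks. An independent transversal (IT) of $G$ with respect to $\mathcal{P}$ is an independent set $\{v_1, \ldots, v_r\}$ of $G$ with $v_i \in V_i$ for every $i$. The local degree of $G$ (with respect to $\mathcal{P}$) is the maximum, over all $v \in V(G)$ and $V_i \in \mathcal{P}$ not containing $v$, of the number of edges between $v$ and $V_i$. The multiplicity of $G$ (with respect to $\mathcal{P}$) is the maximum, over all connected components $C$ of $G$ and $V_i \in \mathcal{P}$, of the number of vertices in $C \cap V_i$. *)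

theory Defs
  imports Complex_Main "HOL-Library.Disjoint_Sets" "Graph_Theory.Graph_Theory"
begin

text \<open>
  A simple graph is a finite symmetric loop-free digraph without parallel arcs (locale
  \<open>graph\<close>, or \<open>pair_graph\<close> when the arcs are ordered pairs of vertices). Each undirected edge
  \<open>{u, v}\<close> is represented by the two arcs from \<open>u\<close> to \<open>v\<close> and from \<open>v\<close> to \<open>u\<close>, so the edges
  at \<open>v\<close> correspond to the outgoing arcs of \<open>v\<close>. The maxima below are taken over finite
  sets of natural numbers; inserting 0 only fixes the value of an empty maximum.
\<close>

definition max_degree :: "('a, 'b) pre_digraph \<Rightarrow> nat" where
  "max_degree G = Max (insert 0 {out_degree G v | v. v \<in> verts G})"

definition edges_to :: "('a, 'b) pre_digraph \<Rightarrow> 'a \<Rightarrow> 'a set \<Rightarrow> 'b set" where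
  "edges_to G v V = {e \<in> out_arcs G v. head G e \<in> V}"

definition local_degree :: "('a, 'b) pre_digraph \<Rightarrow> 'a set set \<Rightarrow> nat" where
  "local_degree G P =
     Max (insert 0 {card (edges_to G v V) | v V. v \<in> verts G \<and> V \<in> P \<and> v \<notin> V})"

text \<open>
  The qualified name avoids topological connectedness.
\<close>

definition component :: "('a, 'b) pre_digraph \<Rightarrow> ('a, 'b) pre_digraph \<Rightarrow> bool" where
  "component G C \<longleftrightarrow> pre_digraph.max_subgraph G Digraph_Component.connected C"

definition multiplicity :: "('a, 'b) pre_digraph \<Rightarrow> 'a set set \<Rightarrow> nat" where
  "multiplicity G P =
     Max (insert 0 {card (verts C \<inter> V) | C V. component G C \<and> V \<in> P})"

definition independent_set :: "('a, 'b) pre_digraph \<Rightarrow> 'a set \<Rightarrow> bool" where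
  "independent_set G S \<longleftrightarrow>
     S \<subseteq> verts G \<and> (\<forall>u\<in>S. \<forall>v\<in>S. (u, v) \<notin> arcs_ends G)"

definition independent_transversal ::
    "('a, 'b) pre_digraph \<Rightarrow> 'a set set \<Rightarrow> 'a set \<Rightarrow> bool" where
  "independent_transversal G P T \<longleftrightarrow>
     independent_set G T \<and> (\<exists>f. (\<forall>V\<in>P. f V \<in> V) \<and> T = f ` P)"

end

theory Submission
  imports Defs "HOL-Library.Countable"
begin

text \<open>
  Write \<open>d = k m\<close>. A cluster consists of \<open>k + 1\<close> blocks and \<open>k\<close> copies of the complete
  \<open>(k + 1)\<close>-partite graph with classes of size \<open>m\<close>, one class in each block. An independent set
  meets only one class of each copy, so a transversal must use a further vertex in some block of
  every cluster. These further vertices come from copies of \<open>K\<^sub>d\<^sub>,\<^sub>d\<close>, of which only one side can be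
  used: clusters \<open>0, \<dots>, d - 1\<close> form a caterpillar whose \<open>i\<close>-th connector (\<open>i < d - 1\<close>) has one side
  in cluster \<open>i + 1\<close> and the other in clusters \<open>i - 1\<close> and \<open>i\<close>, and a last connector joins two
  such caterpillars. A transversal misses the last connector in one of the two caterpillars; going
  down from there, cluster \<open>i + 1\<close> has to be served by its own side of connector \<open>i\<close>, which
  makes the other side unavailable below, and cluster \<open>0\<close> is left unserved. Every cluster
  receives exactly \<open>2d - 1\<close> connector vertices, and dealing them out cyclically gives each block
  at least \<open>d + \<lfloor>(2d - 1)/(k + 1)\<rfloor>\<close> vertices, which is the claimed bound.
\<close>

section \<open>Disjoint unions of complete multipartite graphs\<close>

text \<open>Each vertex carries three labels: its copy, its class inside the copy, and its block.
  All graph parameters then become counts of vertices with prescribed labels.\<close>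

locale multipartite_family =
  fixes S :: "'v set" and comp :: "'v \<Rightarrow> 'c" and part :: "'v \<Rightarrow> 'p" and blk :: "'v \<Rightarrow> 'b"
  assumes finite_S: "finite S"
begin

definition G :: "'v pair_pre_digraph" where
  "G = \<lparr>pverts = S, parcs = {(u, v). u \<in> S \<and> v \<in> S \<and> comp u = comp v \<and> part u \<noteq> part v}\<rparr>"

definition block :: "'b \<Rightarrow> 'v set" where
  "block b = {v \<in> S. blk v = b}"

text \<open>Ranging only over labels that occur keeps the empty set out, as
  \<open>partition_on\<close> demands.\<close>

definition P :: "'v set set" where
  "P = block ` blk ` S"

definition fibre :: "'v \<Rightarrow> 'v set" where
  "fibre v = {u \<in> S. comp u = comp v}"

definition nbrs :: "'v \<Rightarrow> 'v set" where
  "nbrs v = {u \<in> fibre v. part u \<noteq> part v}"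

lemma finite_fibre: "finite (fibre v)"
  using finite_S by (simp add: fibre_def)

lemma pverts_G [simp]: "pverts G = S"
  by (simp add: G_def)

lemma parcs_G_iff: "(u, v) \<in> parcs G \<longleftrightarrow> u \<in> S \<and> v \<in> nbrs u"
  by (auto simp: G_def nbrs_def fibre_def)

lemma pair_graph_G: "pair_graph G"
proof
  show "finite (parcs G)"
    by (rule finite_subset[of _ "S \<times> S"]) (auto simp: G_def finite_S)
  show "symmetric (with_proj G)"
    by (auto simp: symmetric_def sym_def G_def)
qed (auto simp: G_def finite_S)

lemma partition_on_P: "partition_on S P"
  by (rule partition_onI) (auto simp: P_def block_def disjnt_def)

lemma out_arcs_G: "v \<in> S \<Longrightarrow> out_arcs (with_proj G) v = Pair v ` nbrs v"
  by (auto simp: out_arcs_def parcs_G_iff)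

lemma out_degree_G: "v \<in> S \<Longrightarrow> out_degree (with_proj G) v = card (nbrs v)"
  by (simp add: out_degree_def out_arcs_G card_image inj_on_def)

lemma edges_to_G:
  assumes "v \<in> S"
  shows "card (edges_to (with_proj G) v V) = card (nbrs v \<inter> V)"
proof -
  have "edges_to (with_proj G) v V = Pair v ` (nbrs v \<inter> V)"
    using assms by (auto simp: edges_to_def out_arcs_G)
  then show ?thesis by (simp add: card_image inj_on_def)
qed

section \<open>Degree, local degree and multiplicity as label counts\<close>

lemma Max_insert_0_eqI:
  fixes A :: "nat set"
  assumes "\<And>x. x \<in> A \<Longrightarrow> x \<le> n" and "n \<in> A"
  shows "Max (insert 0 A) = n"
proof (rule Max_eqI)
  have "A \<subseteq> {..n}" using assms(1) by auto
  then show "finite (insert 0 A)" using finite_subset by auto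
qed (use assms in auto)

lemma max_degree_G:
  assumes "\<And>v. v \<in> S \<Longrightarrow> card (nbrs v) \<le> D" and "w \<in> S" and "card (nbrs w) = D"
  shows "max_degree (with_proj G) = D"
  unfolding max_degree_def
proof (rule Max_insert_0_eqI)
  show "D \<in> {out_degree (with_proj G) v |v. v \<in> verts (with_proj G)}"
    using assms(2) out_degree_G[OF assms(2), unfolded assms(3)]
    unfolding mem_Collect_eq with_proj_simps pverts_G by metis
qed (use assms(1) out_degree_G in auto)

text \<open>Bounding the whole fibre, not just the neighbours, lets the same hypothesis
  \<open>le\<close> serve for the multiplicity as well.\<close>

lemma local_degree_G:
  assumes le: "\<And>v b. v \<in> S \<Longrightarrow> card (fibre v \<inter> block b) \<le> M"
    and w: "w \<in> S" "b \<in> blk ` S" "b \<noteq> blk w" "card (nbrs w \<inter> block b) = M"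
  shows "local_degree (with_proj G) P = M"
  unfolding local_degree_def
proof (rule Max_insert_0_eqI)
  fix x assume "x \<in> {card (edges_to (with_proj G) v V) |v V.
                       v \<in> verts (with_proj G) \<and> V \<in> P \<and> v \<notin> V}"
  then obtain v b where v: "v \<in> S" and x: "x = card (nbrs v \<inter> block b)"
    by (auto simp: edges_to_G P_def)
  have "x \<le> card (fibre v \<inter> block b)"
    unfolding x by (rule card_mono) (auto simp: finite_fibre nbrs_def)
  then show "x \<le> M" using le[OF v, of b] by linarith
next
  have "block b \<in> P" "w \<notin> block b" using w by (auto simp: P_def block_def)
  then show "M \<in> {card (edges_to (with_proj G) v V) |v V.
                     v \<in> verts (with_proj G) \<and> V \<in> P \<and> v \<notin> V}"
    using w(1) edges_to_G[OF w(1), of "block b", unfolded w(4)]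
    unfolding mem_Collect_eq with_proj_simps pverts_G by metis
qed

text \<open>Arcs preserve \<open>comp\<close>, hence so do walks. In general a component can be
  smaller than the fibre: a fibre with a single class has no arcs.\<close>

lemma connected_subgraph_in_fibre:
  assumes sub: "subgraph H (with_proj G)" and con: "Digraph_Component.connected H"
    and v: "v \<in> verts H"
  shows "verts H \<subseteq> fibre v"
proof
  fix u assume u: "u \<in> verts H"
  have ends: "arcs_ends H \<subseteq> parcs G"
    using sub by (auto simp: arcs_ends_conv subgraph_def compatible_def)
  have "(v, u) \<in> rtrancl_on (verts H) ((arcs_ends H)\<^sup>s)"
    using con u v by (simp add: connected_conv)
  then have "comp u = comp v"
  proof (induction rule: rtrancl_on_induct)
    case (step x y)
    then have "(x, y) \<in> parcs G \<or> (y, x) \<in> parcs G"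
      using ends by (auto simp: symcl_def)
    then show ?case using step by (auto simp: G_def)
  qed simp
  then show "u \<in> fibre v"
    using sub u by (auto simp: fibre_def subgraph_def)
qed

text \<open>A neighbour of \<open>v\<close> provides a second class, which makes the induced
  subgraph on the fibre connected; it is maximal because no connected subgraph leaves the
  fibre.\<close>

lemma component_fibre:
  assumes v: "v \<in> S" and ne: "nbrs v \<noteq> {}"
  obtains C where "component (with_proj G) C" "verts C = fibre v"
proof -
  define F where "F = \<lparr>pverts = fibre v, parcs = parcs G \<inter> fibre v \<times> fibre v\<rparr>"
  let ?C = "with_proj F"
  have [simp]: "pverts F = fibre v" by (simp add: F_def)
  have wf: "wf_digraph ?C" by unfold_locales (auto simp: F_def)
  have wfG: "wf_digraph (with_proj G)" by unfold_locales (auto simp: G_def)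
  have sub: "subgraph ?C (with_proj G)"
    using wf wfG by (auto simp: subgraph_def F_def fibre_def)
  have adj: "(x, y) \<in> rtrancl_on (fibre v) ((parcs F)\<^sup>s)"
    if "x \<in> fibre v" "y \<in> fibre v" "part x \<noteq> part y" for x y
  proof -
    have "(x, y) \<in> (parcs F)\<^sup>s"
      using that by (auto simp: F_def G_def fibre_def symcl_def)
    then show ?thesis using that by (auto intro: rtrancl_on_into_rtrancl_on rtrancl_on_refl)
  qed
  obtain w where w: "w \<in> fibre v" "part w \<noteq> part v" using ne by (auto simp: nbrs_def)
  have vf: "v \<in> fibre v" using v by (simp add: fibre_def)
  have "(x, y) \<in> rtrancl_on (fibre v) ((parcs F)\<^sup>s)"
    if "x \<in> fibre v" "y \<in> fibre v" for x y
  proof (cases "part x = part y")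
    case True
    \<comment> \<open>Two vertices of one class are linked through a vertex of another class;
      \<open>v\<close> or \<open>w\<close> is such a vertex, since their classes differ.\<close>
    obtain z where "z \<in> fibre v" "part z \<noteq> part x" using w vf by metis
    then show ?thesis
      using adj[of x z] adj[of z y] that True rtrancl_on_trans[of x z _ _ y] by simp
  qed (rule adj[OF that])
  then have con: "Digraph_Component.connected ?C"
    using vf by (auto simp: connected_conv)
  have max: "H = ?C"
    if H: "subgraph ?C H" "subgraph H (with_proj G)" "Digraph_Component.connected H" for H
  proof -
    have "v \<in> verts H" using H(1) vf by (auto simp: subgraph_def)
    then have le: "verts H \<subseteq> fibre v" using connected_subgraph_in_fibre H by blast
    have th: "tail H = fst" "head H = snd"
      using H(2) by (auto simp: subgraph_def compatible_def)
    \<comment> \<open>\<open>F\<close> has all arcs of \<open>G\<close> inside the fibre, so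
      \<open>H\<close> can have no further ones once its vertices lie there.\<close>
    have "arcs H \<subseteq> parcs F"
    proof
      fix e assume e: "e \<in> arcs H"
      have "wf_digraph H" using H(2) by (simp add: subgraph_def)
      then have "fst e \<in> verts H" "snd e \<in> verts H"
        using wf_digraph.tail_in_verts wf_digraph.head_in_verts e th by metis+
      then show "e \<in> parcs F"
        using le e H(2) by (cases e) (auto simp: F_def subgraph_def)
    qed
    then have "arcs H = arcs ?C" "verts H = verts ?C"
      using le H(1) by (auto simp: subgraph_def)
    then show ?thesis using th by (intro pre_digraph.equality) auto
  qed
  have "component (with_proj G) ?C"
    unfolding component_def using sub con max by (auto simp: pre_digraph.max_subgraph_def)
  then show ?thesis using that by simp
qed

lemma multiplicity_G:
  assumes le: "\<And>v b. v \<in> S \<Longrightarrow> card (fibre v \<inter> block b) \<le> M"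
    and w: "w \<in> S" "nbrs w \<noteq> {}" "b \<in> blk ` S" "card (fibre w \<inter> block b) = M"
  shows "multiplicity (with_proj G) P = M"
  unfolding multiplicity_def
proof (rule Max_insert_0_eqI)
  fix x assume "x \<in> {card (verts C \<inter> V) |C V. component (with_proj G) C \<and> V \<in> P}"
  then obtain C b where C: "component (with_proj G) C" and x: "x = card (verts C \<inter> block b)"
    by (auto simp: P_def)
  have sub: "subgraph C (with_proj G)" and con: "Digraph_Component.connected C"
    using C by (auto simp: component_def pre_digraph.max_subgraph_def)
  obtain v where v: "v \<in> verts C" using con by (auto simp: connected_conv)
  then have "v \<in> S" using sub by (auto simp: subgraph_def)
  moreover have "x \<le> card (fibre v \<inter> block b)"
    unfolding x using connected_subgraph_in_fibre[OF sub con v]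
    by (intro card_mono) (auto simp: finite_fibre)
  ultimately show "x \<le> M" using le[of v b] by linarith
next
  obtain C where "component (with_proj G) C" "verts C = fibre w"
    using component_fibre w(1,2) by blast
  moreover have "block b \<in> P" using w(3) by (simp add: P_def)
  ultimately show "M \<in> {card (verts C \<inter> V) |C V. component (with_proj G) C \<and> V \<in> P}"
    unfolding mem_Collect_eq w(4)[symmetric] by metis
qed

text \<open>The choice function is reindexed by block labels, so that later arguments deal with
  labels only and never with arcs.\<close>

lemma independent_transversal_G:
  assumes "independent_transversal (with_proj G) P T"
  obtains g where "\<And>b. b \<in> blk ` S \<Longrightarrow> g b \<in> block b"
    and "\<And>b b'. b \<in> blk ` S \<Longrightarrow> b' \<in> blk ` S \<Longrightarrow> comp (g b) = comp (g b') \<Longrightarrow> part (g b) = part (g b')"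
proof -
  obtain f where ind: "independent_set (with_proj G) T" and f: "\<And>V. V \<in> P \<Longrightarrow> f V \<in> V"
    and T: "T = f ` P"
    using assms by (auto simp: independent_transversal_def)
  show thesis
  proof (rule that[of "\<lambda>b. f (block b)"])
    show "f (block b) \<in> block b" if "b \<in> blk ` S" for b
      using that f by (auto simp: P_def)
  next
    fix b b' assume b: "b \<in> blk ` S" "b' \<in> blk ` S"
      and eq: "comp (f (block b)) = comp (f (block b'))"
    have T': "f (block b) \<in> T" "f (block b') \<in> T" using b T by (auto simp: P_def)
    have "T \<subseteq> S" "(f (block b), f (block b')) \<notin> parcs G"
      using ind T' by (auto simp: independent_set_def)
    then show "part (f (block b)) = part (f (block b'))"
      using eq T' by (auto simp: G_def)
  qed
qed

end

text \<open>The construction uses tuples as vertices; \<open>to_nat\<close> moves it to natural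
  numbers, keeping all label counts. A single vertex \<open>w\<close> and block \<open>b\<close>
  witness that all three maxima are attained.\<close>

lemma multipartite_realization_nat:
  fixes S :: "'v::countable set" and comp :: "'v \<Rightarrow> 'c" and part :: "'v \<Rightarrow> 'p" and blk :: "'v \<Rightarrow> 'b"
  assumes fin: "finite S"
    and deg_le: "\<And>v. v \<in> S \<Longrightarrow> card {u \<in> S. comp u = comp v \<and> part u \<noteq> part v} \<le> D"
    and mult_le: "\<And>v b. v \<in> S \<Longrightarrow> card {u \<in> S. comp u = comp v \<and> blk u = b} \<le> M"
    and w: "w \<in> S" "b \<in> blk ` S" "b \<noteq> blk w" "D > 0"
    and deg_w: "card {u \<in> S. comp u = comp w \<and> part u \<noteq> part w} = D"
    and mult_w: "card {u \<in> S. comp u = comp w \<and> part u \<noteq> part w \<and> blk u = b} = M"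
    and size: "\<And>b. b \<in> blk ` S \<Longrightarrow> N \<le> card {v \<in> S. blk v = b}"
    and no_transversal: "\<And>g. (\<And>b. b \<in> blk ` S \<Longrightarrow> g b \<in> S \<and> blk (g b) = b) \<Longrightarrow>
           \<exists>b\<in>blk ` S. \<exists>b'\<in>blk ` S. comp (g b) = comp (g b') \<and> part (g b) \<noteq> part (g b')"
  shows "\<exists>(G :: nat pair_pre_digraph) (P :: nat set set).
           pair_graph G \<and> partition_on (pverts G) P \<and>
           max_degree (with_proj G) = D \<and> local_degree (with_proj G) P = M \<and>
           multiplicity (with_proj G) P = M \<and> (\<forall>V\<in>P. N \<le> card V) \<and>
           \<not> (\<exists>T. independent_transversal (with_proj G) P T)"
proof -
  let ?S = "to_nat ` S"
  interpret F: multipartite_family ?S "comp \<circ> from_nat" "part \<circ> from_nat" "blk \<circ> from_nat"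
    by unfold_locales (use fin in simp)
  have blks: "(blk \<circ> from_nat) ` ?S = blk ` S" by (simp add: image_comp)
  have card_conv: "card {n \<in> ?S. Q (from_nat n)} = card {v \<in> S. Q v}" for Q
  proof -
    have "{n \<in> ?S. Q (from_nat n)} = to_nat ` {v \<in> S. Q v}" by auto
    then show ?thesis by (simp add: card_image inj_on_def)
  qed
  have nbrs: "card (F.nbrs (to_nat v)) = card {u \<in> S. comp u = comp v \<and> part u \<noteq> part v}" for v
    using card_conv[of "\<lambda>u. comp u = comp v \<and> part u \<noteq> part v"]
    by (simp add: F.nbrs_def F.fibre_def conj_assoc)
  have nbrs_block: "card (F.nbrs (to_nat v) \<inter> F.block c) =
      card {u \<in> S. comp u = comp v \<and> part u \<noteq> part v \<and> blk u = c}" for v c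
  proof -
    have "F.nbrs (to_nat v) \<inter> F.block c =
        {n \<in> ?S. comp (from_nat n) = comp v \<and> part (from_nat n) \<noteq> part v \<and> blk (from_nat n) = c}"
      by (auto simp: F.nbrs_def F.fibre_def F.block_def)
    then show ?thesis
      using card_conv[of "\<lambda>u. comp u = comp v \<and> part u \<noteq> part v \<and> blk u = c"] by simp
  qed
  have fibre_block: "card (F.fibre (to_nat v) \<inter> F.block c) =
      card {u \<in> S. comp u = comp v \<and> blk u = c}" for v c
  proof -
    have "F.fibre (to_nat v) \<inter> F.block c =
        {n \<in> ?S. comp (from_nat n) = comp v \<and> blk (from_nat n) = c}"
      by (auto simp: F.fibre_def F.block_def)
    then show ?thesis
      using card_conv[of "\<lambda>u. comp u = comp v \<and> blk u = c"] by simp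
  qed
  have le: "card (F.fibre v \<inter> F.block c) \<le> M" if "v \<in> ?S" for v c
    using that mult_le fibre_block by auto
  have w': "to_nat w \<in> ?S" "b \<in> (blk \<circ> from_nat) ` ?S" "b \<noteq> (blk \<circ> from_nat) (to_nat w)"
      "card (F.nbrs (to_nat w)) = D" "F.nbrs (to_nat w) \<noteq> {}"
      "card (F.nbrs (to_nat w) \<inter> F.block b) = M"
    using w deg_w mult_w nbrs[of w] nbrs_block[of w b] blks by auto
  \<comment> \<open>The neighbours of \<open>w\<close> in \<open>b\<close> already number
    \<open>M\<close>, so the upper bound \<open>le\<close> forces equality for the whole
    fibre.\<close>
  have "M \<le> card (F.fibre (to_nat w) \<inter> F.block b)"
    unfolding w'(6)[symmetric] by (rule card_mono) (auto simp: F.finite_fibre F.nbrs_def)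
  then have fw: "card (F.fibre (to_nat w) \<inter> F.block b) = M"
    using le[OF w'(1), of b] by linarith
  have "max_degree (with_proj F.G) = D"
    by (rule F.max_degree_G[OF _ w'(1,4)]) (auto simp: nbrs deg_le)
  moreover have "local_degree (with_proj F.G) F.P = M"
    by (rule F.local_degree_G[OF le w'(1,2,3,6)])
  moreover have "multiplicity (with_proj F.G) F.P = M"
    by (rule F.multiplicity_G[OF le w'(1,5,2) fw])
  moreover have "N \<le> card V" if V: "V \<in> F.P" for V
  proof -
    obtain c where c: "V = F.block c" "c \<in> blk ` S" using V unfolding F.P_def blks by blast
    then show ?thesis
      using size[OF c(2)] card_conv[of "\<lambda>v. blk v = c"] by (simp add: F.block_def c(1))
  qed
  moreover have "\<not> independent_transversal (with_proj F.G) F.P T" for T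
  proof
    assume "independent_transversal (with_proj F.G) F.P T"
    then obtain g where g: "\<And>c. c \<in> blk ` S \<Longrightarrow> g c \<in> F.block c"
      and same: "\<And>c c'. c \<in> blk ` S \<Longrightarrow> c' \<in> blk ` S \<Longrightarrow>
        comp (from_nat (g c)) = comp (from_nat (g c')) \<Longrightarrow>
        part (from_nat (g c)) = part (from_nat (g c'))"
      by (rule F.independent_transversal_G) (auto simp: blks[unfolded comp_def] comp_def)
    have "from_nat (g c) \<in> S \<and> blk (from_nat (g c)) = c" if "c \<in> blk ` S" for c
      using g[OF that] by (auto simp: F.block_def)
    from no_transversal[of "\<lambda>c. from_nat (g c)", OF this] same show False by blast
  qed
  ultimately show ?thesis
    using F.pair_graph_G F.partition_on_P by (intro exI[of _ F.G] exI[of _ F.P]) simp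
qed

section \<open>The construction\<close>

lemma card_residue_window:
  fixes a b q :: nat
  assumes "b < q"
  shows "card {n \<in> {a..<a + q}. n mod q = b} = 1"
proof -
  have inj: "inj_on (\<lambda>n. n mod q) {a..<a + q}"
  proof (rule linorder_inj_onI')
    fix i j assume ij: "i \<in> {a..<a + q}" "j \<in> {a..<a + q}" "i < j"
    then have "\<not> q dvd j - i" by (auto dest: dvd_imp_le)
    then show "i mod q \<noteq> j mod q"
      using ij by (metis mod_eq_dvd_iff_nat less_imp_le)
  qed
  \<comment> \<open>An injection from \<open>q\<close> consecutive numbers into the \<open>q\<close>
    residues is onto.\<close>
  have "(\<lambda>n. n mod q) ` {a..<a + q} = {..<q}"
    using assms by (intro card_subset_eq) (auto simp: card_image[OF inj])
  then obtain n where n: "n \<in> {a..<a + q}" "n mod q = b"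
    using assms by (metis imageE lessThan_iff)
  then have "{n \<in> {a..<a + q}. n mod q = b} = {n}"
    using inj by (auto simp: inj_on_def)
  then show ?thesis by simp
qed

text \<open>Taken with \<open>q = k + 1\<close>, this yields the block sizes, the multiplicity bound
  and the class sizes of the multipartite graphs.\<close>

lemma card_residue_interval:
  fixes a b q :: nat
  assumes "b < q"
  shows "card {n \<in> {a..<a + q * j}. n mod q = b} = j"
proof (induction j)
  case (Suc j)
  have "{n \<in> {a..<a + q * Suc j}. n mod q = b} =
        {n \<in> {a..<a + q * j}. n mod q = b} \<union> {n \<in> {a + q * j..<a + q * j + q}. n mod q = b}"
    by auto
  then show ?case
    using Suc card_residue_window[OF assms, of "a + q * j"] by (simp add: card_Un_disjoint disjoint_iff)
qed simp

section \<open>Numbering of the vertices of clusters and connectors\<close>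

locale cluster_path =
  fixes k m :: nat
  assumes k_pos: "0 < k" and m_pos: "0 < m"
begin

definition d :: nat where "d = k * m"

text \<open>The joint size of \<open>k\<close> complete \<open>(k + 1)\<close>-partite graphs with
  classes of size \<open>m\<close>.\<close>

definition W :: nat where "W = (k + 1) * d"

text \<open>Cluster \<open>c\<close> has \<open>2 * d - 1\<close> connector vertices: one full side
  of \<open>d\<close>, then \<open>c\<close> in connector \<open>c\<close> and
  \<open>d - 1 - c\<close> in connector \<open>c + 1\<close>.\<close>

definition L :: nat where "L = W + (2 * d - 1)"

text \<open>
  A vertex \<open>(q, c, n)\<close> is the \<open>n\<close>-th vertex of cluster \<open>c\<close> in caterpillar \<open>q\<close>; those with
  \<open>n < W\<close> belong to the cluster's own complete multipartite graphs. For \<open>n = W + p\<close>,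
  \<open>slot c p = (i, s)\<close> puts the vertex into connector \<open>i\<close>, where \<open>s\<close> marks the side lying
  entirely in cluster \<open>i + 1\<close>. The other side has its first \<open>i\<close> vertices in cluster \<open>i\<close> and the
  remaining \<open>d - i\<close> in cluster \<open>i - 1\<close> (all of them in cluster \<open>0\<close> if \<open>i = 0\<close>).
  Connector \<open>d - 1\<close> is shared by the two caterpillars, and its sides are given by \<open>q\<close>.
\<close>

definition slot :: "nat \<Rightarrow> nat \<Rightarrow> nat \<times> bool" where
  "slot c p =
    (if p < d then (if c = 0 then (0, False) else (c - 1, True))
     else if p < d + c then (c, False) else (c + 1, False))"

definition S :: "(bool \<times> nat \<times> nat) set" where
  "S = UNIV \<times> {..<d} \<times> {..<L}"

fun comp :: "bool \<times> nat \<times> nat \<Rightarrow> bool \<times> nat \<times> nat + bool \<times> nat" where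
  "comp (q, c, n) =
    (if n < W then Inl (q, c, n div ((k + 1) * m))
     else let i = fst (slot c (n - W)) in Inr (i = d - 1 \<or> q, i))"

fun part :: "bool \<times> nat \<times> nat \<Rightarrow> nat" where
  "part (q, c, n) =
    (if n < W then n mod (k + 1)
     else let (i, s) = slot c (n - W) in of_bool (if i = d - 1 then q else s))"

text \<open>Below \<open>W\<close> the residue is also the class, so each class of a multipartite
  graph lies in one block.\<close>

fun blk :: "bool \<times> nat \<times> nat \<Rightarrow> bool \<times> nat \<times> nat" where
  "blk (q, c, n) = (q, c, n mod (k + 1))"

lemma d_pos: "0 < d"
  using k_pos m_pos by (simp add: d_def)

lemma d_le: "d \<le> (k + 1) * m"
  by (simp add: d_def)

lemma W_eq: "W = k * ((k + 1) * m)"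
  by (simp add: W_def d_def algebra_simps)

lemma Suc_k_le_W: "k + 1 \<le> W"
  using d_pos by (cases d) (auto simp: W_def)

lemma S_iff: "(q, c, n) \<in> S \<longleftrightarrow> c < d \<and> n < L"
  by (simp add: S_def)

lemma finite_S: "finite S"
  by (simp add: S_def)

lemma blk_image: "blk ` S = UNIV \<times> {..<d} \<times> {..<k + 1}"
proof
  show "UNIV \<times> {..<d} \<times> {..<k + 1} \<subseteq> blk ` S"
  proof
    fix x :: "bool \<times> nat \<times> nat" assume "x \<in> UNIV \<times> {..<d} \<times> {..<k + 1}"
    then obtain q c r where x: "x = (q, c, r)" "c < d" "r < k + 1" by auto
    \<comment> \<open>A label is itself a vertex fixed by \<open>blk\<close>, because its residue is
      below \<open>W\<close>.\<close>
    then have "blk x = x" "x \<in> S" using Suc_k_le_W by (auto simp: S_iff L_def)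
    then show "x \<in> blk ` S" by (metis imageI)
  qed
qed (auto simp: S_def)

text \<open>Only the complete rounds of the cyclic dealing are counted.\<close>

lemma block_size:
  assumes "b \<in> blk ` S"
  shows "L div (k + 1) \<le> card {v \<in> S. blk v = b}"
proof -
  obtain q c r where b: "b = (q, c, r)" "c < d" "r < k + 1"
    using assms unfolding blk_image by auto
  let ?N = "{n \<in> {0..<0 + (k + 1) * (L div (k + 1))}. n mod (k + 1) = r}"
  have "(\<lambda>n. (q, c, n)) ` ?N \<subseteq> {v \<in> S. blk v = b}"
    using b times_div_less_eq_dividend[of "k + 1" L] by (auto simp: S_iff simp del: times_div_less_eq_dividend)
  then have "card ((\<lambda>n. (q, c, n)) ` ?N) \<le> card {v \<in> S. blk v = b}"
    by (rule card_mono[rotated]) (simp add: finite_S)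
  moreover have "card ((\<lambda>n. (q, c, n)) ` ?N) = card ?N"
    by (rule card_image) (simp add: inj_on_def)
  moreover have "card ?N = L div (k + 1)"
    by (rule card_residue_interval[OF b(3)])
  ultimately show ?thesis by linarith
qed

section \<open>The bound on the multiplicity\<close>

lemma div_eq_window:
  fixes n l x :: nat
  assumes "0 < x"
  shows "n div x = l \<longleftrightarrow> n \<in> {l * x..<l * x + x}"
  using assms div_times_less_eq_dividend[of n x] dividend_less_div_times[of x n]
  by (auto intro: div_nat_eqI simp: algebra_simps)

text \<open>A cluster meets a connector in only one of the ranges of \<open>slot\<close>, which is
  an interval of length at most \<open>d\<close>; a multipartite graph is an interval by division.
  So every residue modulo \<open>k + 1\<close> occurs at most \<open>m\<close> times.\<close>

lemma comp_window:
  assumes "c < d"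
  obtains a where "\<And>n. n < L \<Longrightarrow> comp (q, c, n) = \<kappa> \<Longrightarrow> n \<in> {a..<a + (k + 1) * m}"
proof (cases \<kappa>)
  case (Inl t)
  obtain q' c' l where t: "t = (q', c', l)" by (cases t)
  have "n \<in> {l * ((k + 1) * m)..<l * ((k + 1) * m) + (k + 1) * m}" if "comp (q, c, n) = \<kappa>" for n
  proof -
    have "n div ((k + 1) * m) = l" using that Inl t by (auto simp: Let_def split: if_splits)
    then show ?thesis using div_eq_window[of "(k + 1) * m" n l] m_pos by simp
  qed
  then show thesis using that by blast
next
  case (Inr t)
  obtain x i where t: "t = (x, i)" by (cases t)
  \<comment> \<open>The starting points of the three ranges of \<open>slot\<close>. In cluster
    \<open>0\<close> the first range belongs to connector \<open>0\<close>, and the second is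
    empty.\<close>
  define a where "a = (if c = 0 \<and> i = 0 \<or> i + 1 = c then W else if i = c then W + d else W + d + c)"
  have "n \<in> {a..<a + (k + 1) * m}" if n: "n < L" "comp (q, c, n) = \<kappa>" for n
  proof -
    have "W \<le> n" "fst (slot c (n - W)) = i" using n Inr t by (auto simp: Let_def split: if_splits)
    then have "n \<in> {a..<a + d}"
      using n(1) assms by (auto simp: a_def slot_def L_def split: if_splits)
    then show ?thesis using d_le by auto
  qed
  then show thesis using that by blast
qed

lemma fibre_block_le:
  "card {u \<in> S. comp u = \<kappa> \<and> blk u = b} \<le> m"
proof -
  obtain q c r where b: "b = (q, c, r)" by (cases b)
  show ?thesis
  proof (cases "c < d \<and> r < k + 1")
    case True
    then obtain a where a: "\<And>n. n < L \<Longrightarrow> comp (q, c, n) = \<kappa> \<Longrightarrow> n \<in> {a..<a + (k + 1) * m}"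
      using comp_window by blast
    let ?N = "{n \<in> {a..<a + (k + 1) * m}. n mod (k + 1) = r}"
    have "{u \<in> S. comp u = \<kappa> \<and> blk u = b} \<subseteq> (\<lambda>n. (q, c, n)) ` ?N"
    proof
      fix u assume "u \<in> {u \<in> S. comp u = \<kappa> \<and> blk u = b}"
      then obtain n where u: "u = (q, c, n)" "n < L" "comp (q, c, n) = \<kappa>" "n mod (k + 1) = r"
        using b by (cases u) (auto simp: S_iff simp del: comp.simps)
      then have "n \<in> ?N" using a by blast
      then show "u \<in> (\<lambda>n. (q, c, n)) ` ?N" unfolding u(1) by (rule imageI)
    qed
    then have "card {u \<in> S. comp u = \<kappa> \<and> blk u = b} \<le> card ?N"
      by (rule surj_card_le[rotated]) simp
    then show ?thesis using True card_residue_interval[of r "k + 1" a m] by simp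
  next
    \<comment> \<open>Labels outside the range must be covered too, since the realization lemma asks
      for the bound at every \<open>b\<close>.\<close>
    case False
    have "{u \<in> S. comp u = \<kappa> \<and> blk u = b} = {}"
      using False b by (auto simp: S_iff)
    then show ?thesis by (simp only: card.empty le0)
  qed
qed

section \<open>The bound on the degree\<close>

lemma card_slot_le:
  "card {(c, p). c < d \<and> p < 2 * d - 1 \<and> slot c p = (i, s)} \<le> d" (is "card ?A \<le> d")
proof -
  consider "s" | "\<not> s" "i = 0" | "\<not> s" "0 < i" "i \<le> d" | "\<not> s" "d < i" by linarith
  then show ?thesis
  proof cases
    case 1
    then have "?A \<subseteq> {i + 1} \<times> {..<d}" by (auto simp: slot_def split: if_splits)
    then have "card ?A \<le> card ({i + 1} \<times> {..<d})" by (intro card_mono) auto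
    then show ?thesis by simp
  next
    case 2
    then have "?A \<subseteq> {0} \<times> {..<d}" by (auto simp: slot_def split: if_splits)
    then have "card ?A \<le> card ({0::nat} \<times> {..<d})" by (intro card_mono) auto
    then show ?thesis by simp
  next
    case 3
    \<comment> \<open>The split side: \<open>i\<close> vertices in cluster \<open>i\<close> and
      \<open>d - i\<close> in cluster \<open>i - 1\<close>.\<close>
    let ?B = "{i} \<times> {d..<d + i}" and ?C = "{i - 1} \<times> {d + (i - 1)..<2 * d - 1}"
    have "?A \<subseteq> ?B \<union> ?C" using 3 by (auto simp: slot_def split: if_splits)
    then have "card ?A \<le> card (?B \<union> ?C)" by (intro card_mono) auto
    also have "\<dots> \<le> card ?B + card ?C" by (rule card_Un_le)
    also have "\<dots> = d" using 3 by simp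
    finally show ?thesis .
  next
    case 4
    then have "?A = {}" by (auto simp: slot_def split: if_splits)
    then show ?thesis by (simp only: card.empty le0)
  qed
qed

text \<open>The \<open>True\<close> side of connector \<open>d - 1\<close> would lie in cluster
  \<open>d\<close>, which does not exist. This frees that connector to be shared, with its sides
  told apart by the caterpillar.\<close>

lemma slot_le: "c < d \<Longrightarrow> p < 2 * d - 1 \<Longrightarrow> slot c p = (i, s) \<Longrightarrow> i < d \<and> (i = d - 1 \<longrightarrow> \<not> s)"
  by (auto simp: slot_def split: if_splits)

text \<open>A copy has \<open>(k + 1) * m\<close> vertices, of which the \<open>m\<close> in the own
  class are not neighbours; this leaves \<open>k * m = d\<close>.\<close>

lemma card_nbrs_cluster:
  assumes "c < d" and n: "n < W"
  shows "card {u \<in> S. comp u = comp (q, c, n) \<and> part u \<noteq> part (q, c, n)} = d" (is "card ?A = d")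
proof -
  let ?X = "(k + 1) * m"
  define l where "l = n div ?X"
  define r where "r = n mod (k + 1)"
  let ?I = "{l * ?X..<l * ?X + ?X}"
  have X: "0 < ?X" using m_pos by simp
  have "l < k" unfolding l_def using n X W_eq by (simp add: less_mult_imp_div_less)
  \<comment> \<open>\<open>W\<close> is a multiple of \<open>?X\<close>, so the interval of the copy
    lies entirely below \<open>W\<close>.\<close>
  then have "(l + 1) * ?X \<le> k * ?X" by (intro mult_le_mono1) simp
  then have I: "n' < W" "n' < L" if "n' \<in> ?I" for n' using that W_eq by (auto simp: L_def)
  have inI: "n' div ?X = l \<longleftrightarrow> n' \<in> ?I" for n' using div_eq_window[OF X] .
  have "?A = (\<lambda>n. (q, c, n)) ` (?I - {n \<in> ?I. n mod (k + 1) = r})" (is "_ = ?f ` ?J")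
  proof (intro equalityI subsetI)
    fix u assume u: "u \<in> ?A"
    obtain q' c' n' where u': "u = (q', c', n')" by (cases u)
    have c': "comp u = Inl (q, c, l)" "part u \<noteq> r" using u n by (auto simp: l_def r_def)
    then have "n' < W" "q' = q" "c' = c" "n' div ?X = l"
      unfolding u' by (auto simp: Let_def split: if_splits)
    moreover from this have "n' mod (k + 1) \<noteq> r" using c' u' by simp
    ultimately show "u \<in> ?f ` ?J" using inI u' by blast
  next
    fix u assume "u \<in> ?f ` ?J"
    then obtain n' where u: "u = (q, c, n')" "n' \<in> ?I" "n' mod (k + 1) \<noteq> r" by blast
    then have "n' < W" "n' < L" "n' div ?X = l" using I inI by blast+
    then show "u \<in> ?A" using u n assms(1) by (simp add: S_iff l_def r_def)
  qed
  then have "card ?A = card ?J" by (simp add: card_image inj_on_def)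
  also have "\<dots> = ?X - m"
    using card_residue_interval[of r "k + 1" "l * ?X" m] by (subst card_Diff_subset) (auto simp: r_def)
  finally show ?thesis by (simp add: d_def)
qed

lemma card_nbrs_le:
  assumes "v \<in> S"
  shows "card {u \<in> S. comp u = comp v \<and> part u \<noteq> part v} \<le> d" (is "card ?A \<le> d")
proof -
  obtain q c n where v: "v = (q, c, n)" by (cases v)
  have cn: "c < d" "n < L" using assms v by (auto simp: S_iff)
  show ?thesis
  proof (cases "n < W")
    case True
    then show ?thesis using card_nbrs_cluster[OF cn(1)] v by simp
  next
    case False
    obtain i s where slot_v: "slot c (n - W) = (i, s)" by (cases "slot c (n - W)")
    \<comment> \<open>\<open>q'\<close> and \<open>s'\<close> describe the opposite side: the other
      caterpillar at connector \<open>d - 1\<close>, where only the flag \<open>False\<close>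
      occurs, and the opposite flag in the same caterpillar elsewhere.\<close>
    define q' where "q' = (if i = d - 1 then \<not> q else q)"
    define s' where "s' = (i \<noteq> d - 1 \<and> \<not> s)"
    let ?B = "{(c, p). c < d \<and> p < 2 * d - 1 \<and> slot c p = (i, s')}"
    have "?A \<subseteq> (\<lambda>(c, p). (q', c, W + p)) ` ?B"
    proof
      fix u assume u: "u \<in> ?A"
      obtain q0 c0 n0 where u': "u = (q0, c0, n0)" by (cases u)
      have c0: "c0 < d" "n0 < L" using u u' by (auto simp: S_iff)
      have W: "W \<le> n0" using u u' v False by (auto simp: Let_def split: if_splits)
      obtain i0 s0 where slot_u: "slot c0 (n0 - W) = (i0, s0)" by (cases "slot c0 (n0 - W)")
      have p: "n0 - W < 2 * d - 1" using c0 W by (simp add: L_def)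
      have eqs: "i0 = i" "i = d - 1 \<or> q0 = q"
        using u u' v False W slot_v slot_u by (auto simp: Let_def)
      have "(if i = d - 1 then q0 else s0) \<noteq> (if i = d - 1 then q else s)"
        using u u' v False W slot_v slot_u eqs(1) by auto
      then have "q0 = q'" "s0 = s'"
        using eqs slot_le[OF c0(1) p slot_u] by (auto simp: q'_def s'_def split: if_splits)
      then have "(c0, n0 - W) \<in> ?B" using c0 p slot_u eqs by simp
      moreover have "u = (\<lambda>(c, p). (q', c, W + p)) (c0, n0 - W)" using u' W \<open>q0 = q'\<close> by simp
      ultimately show "u \<in> (\<lambda>(c, p). (q', c, W + p)) ` ?B" by blast
    qed
    moreover have "finite ?B"
      by (rule finite_subset[of _ "{..<d} \<times> {..<2 * d - 1}"]) auto
    ultimately have "card ?A \<le> card ?B" by (meson surj_card_le)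
    then show ?thesis using card_slot_le[of i s'] by linarith
  qed
qed

section \<open>Absence of independent transversals\<close>

lemma no_transversal:
  assumes g: "\<And>b. b \<in> blk ` S \<Longrightarrow> g b \<in> S \<and> blk (g b) = b"
  shows "\<exists>b\<in>blk ` S. \<exists>b'\<in>blk ` S. comp (g b) = comp (g b') \<and> part (g b) \<noteq> part (g b')"
proof (rule ccontr)
  assume "\<not> ?thesis"
  then have same: "part (g b) = part (g b')"
    if "b \<in> blk ` S" "b' \<in> blk ` S" "comp (g b) = comp (g b')" for b b'
    using that by blast
  define num where "num q c r = snd (snd (g (q, c, r)))" for q c r
  have g_num: "g (q, c, r) = (q, c, num q c r)" "num q c r < L" "num q c r mod (k + 1) = r"
    "(q, c, r) \<in> blk ` S"
    if "c < d" "r < k + 1" for q c r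
  proof -
    show b: "(q, c, r) \<in> blk ` S" using that by (simp add: blk_image)
    obtain q' c' n where "g (q, c, r) = (q', c', n)" by (cases "g (q, c, r)")
    then show "g (q, c, r) = (q, c, num q c r)" "num q c r < L" "num q c r mod (k + 1) = r"
      using g[OF b] by (auto simp: num_def S_iff)
  qed
  \<comment> \<open>Pigeonhole: \<open>k + 1\<close> chosen vertices below \<open>W\<close> would
    put two into one of the \<open>k\<close> copies, with different residues and hence in different
    classes.\<close>
  have leaves: "\<exists>r<k + 1. W \<le> num q c r" if c: "c < d" for q c
  proof (rule ccontr)
    assume "\<not> ?thesis"
    then have low: "num q c r < W" if "r < k + 1" for r using that by (meson not_le)
    let ?h = "\<lambda>r. num q c r div ((k + 1) * m)"
    have "?h ` {..<k + 1} \<subseteq> {..<k}"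
      using low by (auto simp: W_eq intro!: less_mult_imp_div_less)
    then have "\<not> inj_on ?h {..<k + 1}"
      using card_inj_on_le[of ?h "{..<k + 1}" "{..<k}"] by auto
    then obtain r r' where r: "r < k + 1" "r' < k + 1" "r \<noteq> r'" "?h r = ?h r'"
      by (auto simp: inj_on_def)
    have low_comp: "comp (g (q, c, x)) = Inl (q, c, ?h x)" if "x < k + 1" for x
      using low[OF that] by (simp only: g_num(1)[OF c that] comp.simps if_True)
    have "comp (g (q, c, r)) = comp (g (q, c, r'))"
      unfolding low_comp[OF r(1)] low_comp[OF r(2)] r(4) ..
    then have "part (g (q, c, r)) = part (g (q, c, r'))"
      by (rule same[OF g_num(4)[OF c r(1)] g_num(4)[OF c r(2)]])
    moreover have "part (g (q, c, x)) = x" if "x < k + 1" for x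
      using low[OF that] g_num(3)[OF c that, of q] by (simp add: g_num(1)[OF c that])
    ultimately show False using r by metis
  qed
  \<comment> \<open>The choice uses side \<open>s\<close> of connector \<open>i\<close> in
    caterpillar \<open>q\<close>.\<close>
  define hit where "hit q i s \<longleftrightarrow>
    (\<exists>c<d. \<exists>r<k + 1. W \<le> num q c r \<and> slot c (num q c r - W) = (i, s))" for q i s
  have hitE: thesis
    if "hit q i s"
      "\<And>c r. c < d \<Longrightarrow> r < k + 1 \<Longrightarrow> W \<le> num q c r \<Longrightarrow> slot c (num q c r - W) = (i, s) \<Longrightarrow> thesis"
    for q i s thesis
    using that(1) unfolding hit_def by (elim exE conjE) (rule that(2))
  have one_side: False if h: "hit q i True" "hit q i False" "i \<noteq> d - 1" for q i
  proof -
    obtain c r where 1: "c < d" "r < k + 1" "W \<le> num q c r" "slot c (num q c r - W) = (i, True)"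
      using h(1) by (rule hitE)
    obtain c' r' where 2: "c' < d" "r' < k + 1" "W \<le> num q c' r'" "slot c' (num q c' r' - W) = (i, False)"
      using h(2) by (rule hitE)
    have "comp (g (q, c, r)) = comp (g (q, c', r'))"
      "part (g (q, c, r)) \<noteq> part (g (q, c', r'))"
      using 1 2 h(3) by (simp_all add: g_num(1))
    then show False using same[OF g_num(4)[OF 1(1,2)] g_num(4)[OF 2(1,2)]] by simp
  qed
  have "\<not> (hit True (d - 1) False \<and> hit False (d - 1) False)"
  proof
    assume "hit True (d - 1) False \<and> hit False (d - 1) False"
    then have h: "hit True (d - 1) False" "hit False (d - 1) False" by simp_all
    obtain c r where 1: "c < d" "r < k + 1" "W \<le> num True c r"
      "slot c (num True c r - W) = (d - 1, False)"
      using h(1) by (rule hitE)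
    obtain c' r' where 2: "c' < d" "r' < k + 1" "W \<le> num False c' r'"
      "slot c' (num False c' r' - W) = (d - 1, False)"
      using h(2) by (rule hitE)
    have "comp (g (True, c, r)) = comp (g (False, c', r'))"
      "part (g (True, c, r)) \<noteq> part (g (False, c', r'))"
      using 1 2 by (simp_all add: g_num(1))
    then show False using same[OF g_num(4)[OF 1(1,2)] g_num(4)[OF 2(1,2)]] by simp
  qed
  \<comment> \<open>The shared connector can be used from one caterpillar only; the descent runs in
    one that misses it.\<close>
  then obtain q where top: "\<not> hit q (d - 1) False" by blast
  have served: "(if c = 0 then hit q 0 False else hit q (c - 1) True) \<or> hit q c False \<or>
      (c + 1 < d \<and> hit q (c + 1) False)" if c: "c < d" for c
  proof -
    obtain r where r: "r < k + 1" "W \<le> num q c r" using leaves[OF c] by blast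
    let ?p = "num q c r - W"
    have p: "?p < 2 * d - 1" using g_num(2)[OF c r(1), of q] r(2) by (simp add: L_def)
    have hit: "hit q (fst (slot c ?p)) (snd (slot c ?p))"
      unfolding hit_def using c r by (metis prod.collapse)
    show ?thesis
    proof (cases "?p < d + c")
      case True
      then show ?thesis using hit by (auto simp: slot_def split: if_splits)
    next
      case False
      then have "slot c ?p = (c + 1, False)" "c + 1 < d" using p by (auto simp: slot_def)
      then show ?thesis using hit by simp
    qed
  qed
  \<comment> \<open>Downward induction along the caterpillar. Cluster \<open>n + 1\<close> cannot
    use the \<open>False\<close> sides of connectors \<open>n + 1\<close> and \<open>n + 2\<close>,
    so it uses the \<open>True\<close> side of connector \<open>n\<close>, which blocks the
    \<open>False\<close> side there.\<close>
  have "\<forall>i. 0 \<le> i \<and> i < d \<longrightarrow> \<not> hit q i False"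
  proof (rule inc_induct[of 0 "d - 1"])
    show "\<forall>i. d - 1 \<le> i \<and> i < d \<longrightarrow> \<not> hit q i False"
    proof (intro allI impI)
      fix i assume "d - 1 \<le> i \<and> i < d"
      then have "i = d - 1" by linarith
      then show "\<not> hit q i False" using top by simp
    qed
  next
    fix n assume n: "n < d - 1" and IH: "\<forall>i. Suc n \<le> i \<and> i < d \<longrightarrow> \<not> hit q i False"
    have "Suc n < d" using n by linarith
    then have "hit q n True"
      using served[of "Suc n"] IH[rule_format, of "Suc n"] IH[rule_format, of "Suc (Suc n)"] by auto
    then have "\<not> hit q n False" using one_side n by blast
    then show "\<forall>i. n \<le> i \<and> i < d \<longrightarrow> \<not> hit q i False"
      using IH by (metis le_neq_implies_less less_eq_Suc_le)
  qed simp
  \<comment> \<open>Cluster \<open>0\<close> has vertices only on \<open>False\<close> sides, all of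
    which are now excluded.\<close>
  then show False using served[OF d_pos] d_pos by auto
qed

section \<open>Assembling the graph\<close>

lemma existence:
  "\<exists>(G :: nat pair_pre_digraph) (P :: nat set set).
     pair_graph G \<and> partition_on (pverts G) P \<and>
     max_degree (with_proj G) = d \<and> local_degree (with_proj G) P = m \<and>
     multiplicity (with_proj G) P = m \<and> (\<forall>V\<in>P. L div (k + 1) \<le> card V) \<and>
     \<not> (\<exists>T. independent_transversal (with_proj G) P T)"
\<comment> \<open>The witness vertex lies in class \<open>0\<close> of the first copy in cluster
  \<open>0\<close>; its neighbours in the block with residue \<open>1\<close> are exactly class
  \<open>1\<close> of that copy.\<close>
proof (rule multipartite_realization_nat[of S comp part d blk m "(False, 0, 0)" "(False, 0, 1)"])
  have W: "0 < W" using Suc_k_le_W by simp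
  show "(False, 0, 0) \<in> S" using d_pos W by (simp add: S_iff L_def)
  show "(False, 0, 1) \<in> blk ` S" using d_pos k_pos by (simp add: blk_image)
  show "card {u \<in> S. comp u = comp (False, 0, 0) \<and> part u \<noteq> part (False, 0, 0)} = d"
    using card_nbrs_cluster[OF d_pos W] .
  let ?X = "(k + 1) * m"
  let ?N = "{n \<in> {0..<0 + ?X}. n mod (k + 1) = 1}"
  have "?X \<le> W" using W_eq k_pos by simp
  have "{u \<in> S. comp u = comp (False, 0, 0) \<and> part u \<noteq> part (False, 0, 0) \<and> blk u = (False, 0, 1)}
      = (\<lambda>n. (False, 0, n)) ` ?N"
  proof (intro equalityI subsetI)
    fix u assume u: "u \<in> {u \<in> S. comp u = comp (False, 0, 0) \<and> part u \<noteq> part (False, 0, 0) \<and>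
      blk u = (False, 0, 1)}"
    then obtain n where n: "u = (False, 0, n)" "n mod (k + 1) = 1" by (cases u) auto
    have "n div ?X = 0" using u n W by (auto simp: Let_def split: if_splits)
    then have "n < ?X" using m_pos by (simp only: div_eq_0_iff) auto
    then show "u \<in> (\<lambda>n. (False, 0, n)) ` ?N" using n by auto
  next
    fix u assume "u \<in> (\<lambda>n. (False, 0::nat, n)) ` ?N"
    then obtain n where n: "u = (False, 0, n)" "n < ?X" "n mod (k + 1) = 1" by auto
    then show "u \<in> {u \<in> S. comp u = comp (False, 0, 0) \<and> part u \<noteq> part (False, 0, 0) \<and>
      blk u = (False, 0, 1)}"
      using \<open>?X \<le> W\<close> d_pos W by (simp add: S_iff L_def)
  qed
  then show "card {u \<in> S. comp u = comp (False, 0, 0) \<and> part u \<noteq> part (False, 0, 0) \<and>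
      blk u = (False, 0, 1)} = m"
    using card_residue_interval[of 1 "k + 1" 0 m] k_pos by (simp add: card_image inj_on_def)
qed (use finite_S card_nbrs_le fibre_block_le d_pos block_size no_transversal in auto)

end

section \<open>The arithmetic of the block sizes\<close>

theorem theorem5:
  fixes d m :: nat
  assumes "1 \<le> m" and "m \<le> d" and "m dvd d"
  shows "\<exists>(G :: nat pair_pre_digraph) (P :: nat set set).
           pair_graph G \<and>
           partition_on (pverts G) P \<and>
           max_degree (with_proj G) = d \<and>
           local_degree (with_proj G) P = m \<and>
           multiplicity (with_proj G) P = m \<and>
           (\<forall>V\<in>P. int (card V) \<ge>
              int d + 2 * int m - \<lceil>(2 * (real m)\<^sup>2 + real m) / (real d + real m)\<rceil>) \<and>
           \<not> (\<exists>T. independent_transversal (with_proj G) P T)"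
proof -
  obtain k where k: "d = k * m" using assms(3) by (metis dvd_div_mult_self)
  interpret C: cluster_path k m using assms k by unfold_locales (auto intro!: gr0I)
  have d: "C.d = d" by (simp add: C.d_def k)
  let ?C = "\<lceil>(2 * (real m)\<^sup>2 + real m) / (real d + real m)\<rceil>"
  \<comment> \<open>Cancelling \<open>m\<close> turns the denominator into the number
    \<open>k + 1\<close> of blocks per cluster.\<close>
  have "(2 * (real m)\<^sup>2 + real m) / (real d + real m) = (2 * real m + 1) / (real k + 1)"
  proof -
    have "2 * (real m)\<^sup>2 + real m = real m * (2 * real m + 1)"
      "real d + real m = real m * (real k + 1)"
      using k by (simp_all add: algebra_simps power2_eq_square)
    then show ?thesis using assms(1) by simp
  qed
  then have "(2 * real m + 1) / (real k + 1) \<le> of_int ?C"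
    by (metis le_of_int_ceiling)
  then have "2 * real m + 1 \<le> of_int ?C * (real k + 1)"
    by (simp add: pos_divide_le_eq)
  also have "2 * real m + 1 = of_int (2 * int m + 1)" by simp
  also have "of_int ?C * (real k + 1) = of_int (?C * (int k + 1))" by simp
  finally have C: "2 * int m + 1 \<le> ?C * (int k + 1)" by (simp only: of_int_le_iff)
  \<comment> \<open>Positivity makes the truncated subtraction in \<open>2 * d - 1\<close>
    exact.\<close>
  have "0 < d" using assms by linarith
  then have "int C.L = (int k + 1) * int d + (2 * int d - 1)"
    by (simp add: C.L_def C.W_def d of_nat_diff algebra_simps)
  \<comment> \<open>Since \<open>2 * m * (k + 1) = 2 * d + 2 * m\<close>, fact \<open>C\<close>
    leaves at most \<open>2 * d - 1\<close> beyond \<open>(k + 1) * d\<close>, which is the size of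
    a cluster.\<close>
  then have "(int d + 2 * int m - ?C) * (int k + 1) \<le> int C.L"
    using C by (simp add: k algebra_simps)
  then have "int d + 2 * int m - ?C \<le> int (C.L div (k + 1))"
    using zdiv_mono1[of "(int d + 2 * int m - ?C) * (int k + 1)" "int C.L" "int k + 1"]
    by (simp add: zdiv_int add.commute)
  moreover obtain G :: "nat pair_pre_digraph" and P :: "nat set set" where
    "pair_graph G" "partition_on (pverts G) P" "max_degree (with_proj G) = d"
    "local_degree (with_proj G) P = m" "multiplicity (with_proj G) P = m"
    "\<forall>V\<in>P. C.L div (k + 1) \<le> card V"
    "\<not> (\<exists>T. independent_transversal (with_proj G) P T)"
    using C.existence unfolding d by blast
  ultimately show ?thesis
    by (intro exI[of _ G] exI[of _ P]) (meson of_nat_mono order_trans conjI)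
qed

end
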